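(* Let $S\subseteq\mathbb{R}^d$ be closed, and let $C\subseteq\mathbb{R}^d$ be a closed convex full-dimensional $S$-free set. Then $C$ is a maximal $S$-free set if and only if there exists a set $I\subseteq\mathbb{R}^d\times\mathbb{R}$ such that $$C = \{\mathbf{x}\in\mathbb{R}^d : \boldsymbol{\alpha}^\top\mathbf{x}\le\alpha_0 \ \text{ for all } (\boldsymbol{\alpha},\alpha_0)\in I\}$$ and for each $(\boldsymbol{\alpha},\alpha_0)\in I$ the inequality $\boldsymbol{\alpha}^\top\mathbf{x}\le\alpha_0$ has an exposing sequence $(\mathbf{x}^t)_{t=1}^\infty$ (with respect to $C$) in $S$.
   Context: Given a closed set $S\subseteq\mathbb{R}^d$, a closed convex set $C\subseteq\mathbb{R}^d$ is $S$-free if its interior contains no point of $S$; it is a maximal $S$-free set if it is $S$-free and is not strictly contained in another ($S$-free, closed convex) set. A convex set is full-dimensional if it has nonempty interior. An inequality is valid for $C$ if every point of $C$ satisfies it. $\|\cdot\|$ is the Euclidean norm. Exposing sequence: let $C\subseteq\mathbb{R}^d$ be convex and let $\boldsymbol{\alpha}^\top\mathbf{x}\le\alpha_0$, with $\boldsymbol{\alpha}\ne\mathbf{0}$, be a valid inequality for $C$. A sequence $(\mathbf{x}^t)_{t=1}^\infty$ in $\mathbb{R}^d$ is an exposing sequence for $\boldsymbol{\alpha}^\top\mathbf{x}\le\alpha_0$ if $\lim_{t\to\infty}(\boldsymbol{\delta}^t,\delta_0^t)=(\boldsymbol{\alpha},\alpha_0)$ for every sequence $((\boldsymbol{\delta}^t,\delta_0^t))_{t=1}^\infty$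 in $\mathbb{R}^d\times\mathbb{R}$ such that, for each $t$, $\|\boldsymbol{\delta}^t\|=\|\boldsymbol{\alpha}\|$, the inequality $(\boldsymbol{\delta}^t)^\top\mathbf{x}\le\delta_0^t$ is valid for $C$, and $(\boldsymbol{\delta}^t)^\top\mathbf{x}^t\ge\delta_0^t$. (In particular, having an exposing sequence presupposes $\boldsymbol{\alpha}\neq\mathbf{0}$.) *)

theory Defs
  imports "HOL-Analysis.Analysis"
begin

definition S_free :: "(real^'d) set \<Rightarrow> (real^'d) set \<Rightarrow> bool" where
  "S_free S C \<longleftrightarrow> closed C \<and> convex C \<and> interior C \<inter> S = {}"

definition maximal_S_free :: "(real^'d) set \<Rightarrow> (real^'d) set \<Rightarrow> bool" where
  "maximal_S_free S C \<longleftrightarrow> S_free S C \<and> \<not> (\<exists>K. S_free S K \<and> C \<subset> K)"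

definition full_dimensional :: "(real^'d) set \<Rightarrow> bool" where
  "full_dimensional C \<longleftrightarrow> interior C \<noteq> {}"

definition valid_ineq :: "(real^'d) set \<Rightarrow> real^'d \<Rightarrow> real \<Rightarrow> bool" where
  "valid_ineq C \<alpha> \<alpha>0 \<longleftrightarrow> (\<forall>x\<in>C. \<alpha> \<bullet> x \<le> \<alpha>0)"

(* The inequality being exposed is itself required to be nontrivial and valid, so the
   predicate is false otherwise. Sequences are indexed from 0 instead of 1. *)
definition exposing_sequence ::
    "(real^'d) set \<Rightarrow> real^'d \<Rightarrow> real \<Rightarrow> (nat \<Rightarrow> real^'d) \<Rightarrow> bool" where
  "exposing_sequence C \<alpha> \<alpha>0 x \<longleftrightarrow>
     \<alpha> \<noteq> 0 \<and> valid_ineq C \<alpha> \<alpha>0 \<and>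
     (\<forall>(\<delta> :: nat \<Rightarrow> real^'d) (\<delta>0 :: nat \<Rightarrow> real).
        (\<forall>t. norm (\<delta> t) = norm \<alpha> \<and> valid_ineq C (\<delta> t) (\<delta>0 t) \<and> \<delta> t \<bullet> x t \<ge> \<delta>0 t)
        \<longrightarrow> (\<lambda>t. (\<delta> t, \<delta>0 t)) \<longlonglongrightarrow> (\<alpha>, \<alpha>0))"

end

theory Submission
  imports Defs
begin

text \<open>
  If \<open>K\<close> is \<open>S\<close>-free and contains \<open>C\<close>, then the points of an exposing sequence in \<open>S\<close> are
  weakly separated from \<open>K\<close>; the separating inequalities are valid for \<open>C\<close>, so they converge
  to the exposed inequality, which is therefore valid for \<open>K\<close> as well.

  Conversely, fix an interior point \<open>p\<close> of \<open>C\<close>. By Krein--Milman, \<open>C\<close> is described by the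
  nonzero extreme points \<open>\<alpha>\<close> of the polar of \<open>C\<close> about \<open>p\<close>, a compact convex set. Deleting a
  neighbourhood of such an \<open>\<alpha>\<close> from the polar describes a strictly larger convex set, whose
  interior contains a point of \<open>S\<close> when \<open>C\<close> is maximal. Every inequality that is valid for \<open>C\<close>
  but not strictly satisfied by this point comes from the deleted neighbourhood; shrinking
  the neighbourhoods yields an exposing sequence.
\<close>

lemma valid_ineq_interior_strict:
  assumes "valid_ineq C \<delta> \<delta>0" "\<delta> \<noteq> 0" "x \<in> interior C"
  shows "\<delta> \<bullet> x < \<delta>0"
proof -
  have "C \<subseteq> {x. \<delta> \<bullet> x \<le> \<delta>0}"
    using assms(1) by (auto simp: valid_ineq_def)
  then have "x \<in> interior {x. \<delta> \<bullet> x \<le> \<delta>0}"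
    using interior_mono assms(3) by blast
  then show ?thesis
    using assms(2) by simp
qed

text \<open>A hyperplane separating \<open>x\<close> from \<open>interior K\<close> bounds all of
  \<open>K\<close>, because a convex set with nonempty interior lies in the closure of that
  interior. The free norm \<open>r\<close> serves the normalisation in
  \<open>exposing_sequence\<close>.\<close>

lemma separating_valid_ineq:
  fixes K :: "(real^'d) set"
  assumes "convex K" "interior K \<noteq> {}" "x \<notin> interior K" "r > 0"
  obtains \<delta> \<delta>0 where "norm \<delta> = r" "valid_ineq K \<delta> \<delta>0" "\<delta> \<bullet> x \<ge> \<delta>0"
proof -
  obtain a b where a: "a \<noteq> 0" "\<forall>y\<in>interior K. a \<bullet> y \<le> b" "a \<bullet> x \<ge> b"
    using separating_hyperplane_sets[of "interior K" "{x}"] assms by (auto simp: convex_interior)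
  have "closure (interior K) \<subseteq> {y. a \<bullet> y \<le> b}"
    using a(2) by (intro closure_minimal) (auto simp: closed_halfspace_le)
  then have K: "a \<bullet> y \<le> b" if "y \<in> K" for y
    using convex_closure_interior[OF assms(1,2)] closure_subset that by blast
  define c where "c = r / norm a"
  have c: "c > 0" using a(1) assms(4) by (simp add: c_def)
  show thesis
  proof
    show "norm (c *\<^sub>R a) = r" using a(1) assms(4) by (simp add: c_def)
    show "valid_ineq K (c *\<^sub>R a) (c * b)"
      using K c by (simp add: valid_ineq_def)
    show "(c *\<^sub>R a) \<bullet> x \<ge> c * b"
      using a(3) c by simp
  qed
qed

lemma exposed_ineq_valid_superset:
  fixes C K :: "(real^'d) set"
  assumes "convex K" "C \<subseteq> K" "interior C \<noteq> {}"
    and "exposing_sequence C \<alpha> \<alpha>0 x" "\<And>t. x t \<notin> interior K"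
  shows "valid_ineq K \<alpha> \<alpha>0"
proof -
  have "\<alpha> \<noteq> 0" using assms(4) by (simp add: exposing_sequence_def)
  moreover have "interior K \<noteq> {}" using interior_mono[OF assms(2)] assms(3) by blast
  ultimately have "\<exists>\<delta> \<delta>0. norm \<delta> = norm \<alpha> \<and> valid_ineq K \<delta> \<delta>0 \<and> \<delta> \<bullet> x t \<ge> \<delta>0" for t
    by (metis separating_valid_ineq[OF assms(1) _ assms(5)] zero_less_norm_iff)
  then obtain \<delta> \<delta>0 where d: "\<And>t. norm (\<delta> t) = norm \<alpha>" "\<And>t. valid_ineq K (\<delta> t) (\<delta>0 t)"
    "\<And>t. \<delta> t \<bullet> x t \<ge> \<delta>0 t"
    by metis
  have "valid_ineq C (\<delta> t) (\<delta>0 t)" for t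
    using d(2)[of t] assms(2) by (auto simp: valid_ineq_def)
  then have lim: "(\<lambda>t. (\<delta> t, \<delta>0 t)) \<longlonglongrightarrow> (\<alpha>, \<alpha>0)"
    using assms(4) d unfolding exposing_sequence_def by blast
  have lims: "\<delta> \<longlonglongrightarrow> \<alpha>" "\<delta>0 \<longlonglongrightarrow> \<alpha>0"
    using tendsto_fst[OF lim] tendsto_snd[OF lim] by simp_all
  show ?thesis
    unfolding valid_ineq_def
  proof
    fix y assume "y \<in> K"
    then have "\<delta> t \<bullet> y \<le> \<delta>0 t" for t
      using d(2) by (simp add: valid_ineq_def)
    then show "\<alpha> \<bullet> y \<le> \<alpha>0"
      by (intro LIMSEQ_le[OF tendsto_inner[OF lims(1) tendsto_const] lims(2)]) auto
  qed
qed

text \<open>The usual polar of \<open>C\<close> translated by \<open>-p\<close>. A point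
  \<open>\<beta>\<close> stands for the inequality
  \<open>\<beta> \<bullet> x \<le> 1 + \<beta> \<bullet> p\<close>, whose slack at \<open>p\<close>
  is 1; membership means that it is valid for \<open>C\<close>.\<close>

definition polar_about :: "(real^'d) set \<Rightarrow> real^'d \<Rightarrow> (real^'d) set" where
  "polar_about C p = {\<beta>. \<forall>x\<in>C. \<beta> \<bullet> (x - p) \<le> 1}"

lemma convex_polar_about: "convex (polar_about C p)"
proof -
  have "polar_about C p = (\<Inter>x\<in>C. {\<beta>. (x - p) \<bullet> \<beta> \<le> 1})"
    by (auto simp: polar_about_def inner_commute)
  then show ?thesis by (simp add: convex_INT convex_halfspace_le)
qed

lemma compact_polar_about:
  assumes "p \<in> interior C"
  shows "compact (polar_about C p)"
proof -
  have "polar_about C p = (\<Inter>x\<in>C. {\<beta>. (x - p) \<bullet> \<beta> \<le> 1})"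
    by (auto simp: polar_about_def inner_commute)
  then have "closed (polar_about C p)" by (simp add: closed_INT closed_halfspace_le)
  moreover have "bounded (polar_about C p)"
  proof -
    obtain r where r: "r > 0" "cball p r \<subseteq> C"
      using assms mem_interior_cball by blast
    have "norm \<beta> \<le> 1 / r" if "\<beta> \<in> polar_about C p" for \<beta>
    proof (cases "\<beta> = 0")
      case False
      \<comment> \<open>The point of \<open>cball p r\<close> where \<open>\<beta>\<close> is
        largest; testing \<open>\<beta>\<close> there gives
        \<open>r * norm \<beta> \<le> 1\<close>.\<close>
      have "p + (r / norm \<beta>) *\<^sub>R \<beta> \<in> C"
        using r False by (intro subsetD[OF r(2)]) (simp add: dist_norm)
      then have "\<beta> \<bullet> ((r / norm \<beta>) *\<^sub>R \<beta>) \<le> 1"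
        using that by (fastforce simp: polar_about_def)
      moreover have "\<beta> \<bullet> ((r / norm \<beta>) *\<^sub>R \<beta>) = r * norm \<beta>"
        using False by (simp add: dot_square_norm power2_eq_square)
      ultimately show ?thesis using r(1) by (simp add: field_simps)
    qed (use r in simp)
    then show ?thesis by (auto simp: bounded_iff)
  qed
  ultimately show ?thesis by (simp add: compact_eq_bounded_closed)
qed

lemma scaled_valid_ineq_in_polar_about:
  assumes "valid_ineq C \<delta> \<delta>0" "\<delta> \<bullet> p < \<delta>0"
  shows "(1 / (\<delta>0 - \<delta> \<bullet> p)) *\<^sub>R \<delta> \<in> polar_about C p"
  using assms by (auto simp: polar_about_def valid_ineq_def inner_diff_right divide_simps)

text \<open>Separating \<open>y\<close> from \<open>C\<close> and normalising the slack at
  \<open>p\<close> to 1 gives some point of the polar that cuts off \<open>y\<close>. If no extreme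
  point did so, a half-space would contain all extreme points and hence, by Krein--Milman, the whole
  polar.\<close>

lemma extreme_polar_about_separates:
  assumes "closed C" "convex C" "p \<in> interior C" "y \<notin> C"
  obtains \<alpha> where "\<alpha> extreme_point_of polar_about C p" "\<alpha> \<bullet> (y - p) > 1"
proof -
  obtain a b where ab: "a \<bullet> y < b" "\<forall>x\<in>C. a \<bullet> x > b"
    using separating_hyperplane_closed_point[OF assms(2,1,4)] by blast
  define \<beta> where "\<beta> = (1 / (- b - (- a) \<bullet> p)) *\<^sub>R (- a)"
  have pC: "p \<in> C" using assms(3) interior_subset by blast
  have \<beta>: "\<beta> \<in> polar_about C p"
    unfolding \<beta>_def
    by (rule scaled_valid_ineq_in_polar_about)
       (use ab pC in \<open>auto simp: valid_ineq_def less_imp_le\<close>)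
  have "\<beta> \<bullet> (y - p) = (a \<bullet> p - a \<bullet> y) / (a \<bullet> p - b)"
    by (simp add: \<beta>_def inner_diff_right diff_divide_distrib)
  moreover have "a \<bullet> p > b" using ab pC by blast
  ultimately have \<beta>y: "\<beta> \<bullet> (y - p) > 1"
    using ab(1) by simp
  show thesis
  proof (rule ccontr)
    assume "\<not> thesis"
    then have "{\<alpha>. \<alpha> extreme_point_of polar_about C p} \<subseteq> {\<alpha>. (y - p) \<bullet> \<alpha> \<le> 1}"
      using that by (force simp: inner_commute)
    then have "convex hull {\<alpha>. \<alpha> extreme_point_of polar_about C p} \<subseteq> {\<alpha>. (y - p) \<bullet> \<alpha> \<le> 1}"
      by (intro hull_minimal) (auto simp: convex_halfspace_le)
    then have "\<beta> \<in> {\<alpha>. (y - p) \<bullet> \<alpha> \<le> 1}"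
      using \<beta> Krein_Milman_Minkowski[OF compact_polar_about[OF assms(3)] convex_polar_about]
      by blast
    with \<beta>y show False by (simp add: inner_commute)
  qed
qed

text \<open>Without the ball, what is left of \<open>P\<close> is compact, and its convex hull
  misses \<alpha>: otherwise \<alpha> would be extreme in that hull too and so belong to the
  generating set. Strict separation from the hull yields \<open>y\<close>.\<close>

lemma extreme_point_strictly_separated:
  fixes \<alpha> :: "'a::euclidean_space"
  assumes "compact P" "convex P" "0 \<in> P" "\<alpha> extreme_point_of P" "\<alpha> \<noteq> 0" "e > 0"
  obtains y where "y \<bullet> \<alpha> > 1" "\<And>\<beta>. \<beta> \<in> P - ball \<alpha> e \<Longrightarrow> y \<bullet> \<beta> \<le> 1"
proof -
  \<comment> \<open>Adjoining 0 forces the separating level \<open>b\<close> to be negative, so that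
    dividing by \<open>b\<close> reverses the inequalities and turns the level into 1.\<close>
  define Q where "Q = insert 0 (P - ball \<alpha> e)"
  have Q: "Q \<subseteq> P" "\<alpha> \<notin> Q" using assms by (auto simp: Q_def)
  have cQ: "compact Q"
    unfolding Q_def using compact_diff[OF assms(1) open_ball] by (rule compact_insert)
  have QP: "convex hull Q \<subseteq> P" using Q(1) assms(2) by (rule hull_minimal)
  have "\<alpha> \<notin> convex hull Q"
  proof
    assume "\<alpha> \<in> convex hull Q"
    then have "\<alpha> extreme_point_of (convex hull Q)"
      using assms(4) QP unfolding extreme_point_of_def by blast
    then show False using extreme_point_of_convex_hull Q(2) by blast
  qed
  then obtain a b where ab: "a \<bullet> \<alpha> < b" "\<forall>x\<in>convex hull Q. a \<bullet> x > b"
    using separating_hyperplane_closed_point[OF convex_convex_hull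
        compact_imp_closed[OF compact_convex_hull[OF cQ]]] by blast
  have "b < 0" using ab(2) hull_inc[of 0 Q convex] by (force simp: Q_def)
  show thesis
  proof
    show "(1 / b) *\<^sub>R a \<bullet> \<alpha> > 1" using ab \<open>b < 0\<close> by (simp add: field_simps)
    show "(1 / b) *\<^sub>R a \<bullet> \<beta> \<le> 1" if "\<beta> \<in> P - ball \<alpha> e" for \<beta>
    proof -
      have "a \<bullet> \<beta> > b" using ab(2) that hull_inc[of \<beta> Q convex] by (simp add: Q_def)
      then show ?thesis using \<open>b < 0\<close> by (simp add: field_simps)
    qed
  qed
qed

lemma maximal_S_free_point_near_extreme:
  fixes C :: "(real^'d) set"
  assumes "maximal_S_free S C" "p \<in> interior C"
    and "\<alpha> extreme_point_of polar_about C p" "\<alpha> \<noteq> 0" "e > 0"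
  obtains x where "x \<in> S"
    "\<And>\<beta>. \<beta> \<in> polar_about C p \<Longrightarrow> \<beta> \<bullet> (x - p) \<ge> 1 \<Longrightarrow> dist \<alpha> \<beta> < e"
proof -
  define P where "P = polar_about C p"
  define K where "K = (\<Inter>\<beta>\<in>P - ball \<alpha> e. {x. \<beta> \<bullet> x \<le> 1 + \<beta> \<bullet> p})"
  have "0 \<in> P" by (simp add: P_def polar_about_def)
  then obtain y where y: "y \<bullet> \<alpha> > 1" "\<And>\<beta>. \<beta> \<in> P - ball \<alpha> e \<Longrightarrow> y \<bullet> \<beta> \<le> 1"
    using extreme_point_strictly_separated[OF compact_polar_about[OF assms(2)]
        convex_polar_about _ assms(3-5)] unfolding P_def by blast
  have "C \<subseteq> K" by (auto simp: K_def P_def polar_about_def inner_diff_right algebra_simps)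
  \<comment> \<open>The point \<open>y + p\<close> witnesses that \<open>K\<close> is strictly
    larger than \<open>C\<close>: it violates only inequalities from the deleted ball, among them
    that of \<alpha>.\<close>
  moreover have "y + p \<in> K" using y(2) by (simp add: K_def inner_add_right inner_commute)
  moreover have "y + p \<notin> C"
  proof
    assume "y + p \<in> C"
    then have "\<alpha> \<bullet> (y + p - p) \<le> 1"
      using assms(3) unfolding extreme_point_of_def polar_about_def by blast
    with y(1) show False by (simp add: inner_commute)
  qed
  ultimately have "\<not> S_free S K" using assms(1) by (auto simp: maximal_S_free_def)
  moreover have "closed K" "convex K"
    by (auto simp: K_def closed_INT closed_halfspace_le convex_INT convex_halfspace_le)
  ultimately obtain x where x: "x \<in> interior K" "x \<in> S" by (auto simp: S_free_def)
  show thesis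
  proof
    show "x \<in> S" by fact
    fix \<beta> assume \<beta>: "\<beta> \<in> polar_about C p" "\<beta> \<bullet> (x - p) \<ge> 1"
    show "dist \<alpha> \<beta> < e"
    proof (rule ccontr)
      assume "\<not> dist \<alpha> \<beta> < e"
      \<comment> \<open>Outside the ball, \<open>\<beta>\<close> is one of the inequalities defining
        \<open>K\<close>, hence strict at the interior point \<open>x\<close>.\<close>
      then have "valid_ineq K \<beta> (1 + \<beta> \<bullet> p)" using \<beta>(1) by (auto simp: K_def P_def valid_ineq_def)
      moreover have "\<beta> \<noteq> 0" using \<beta>(2) by auto
      ultimately have "\<beta> \<bullet> x < 1 + \<beta> \<bullet> p" using valid_ineq_interior_strict x(1) by blast
      with \<beta>(2) show False by (simp add: inner_diff_right)
    qed
  qed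
qed

lemma exposing_sequence_extreme_polar_about:
  fixes C :: "(real^'d) set"
  assumes "maximal_S_free S C" "p \<in> interior C"
    and "\<alpha> extreme_point_of polar_about C p" "\<alpha> \<noteq> 0"
  obtains x where "\<And>t. x t \<in> S" "exposing_sequence C \<alpha> (1 + \<alpha> \<bullet> p) x"
proof -
  have "\<exists>x. x \<in> S \<and> (\<forall>\<beta>\<in>polar_about C p. \<beta> \<bullet> (x - p) \<ge> 1 \<longrightarrow> dist \<alpha> \<beta> < inverse (real (Suc t)))"
    for t
    by (rule maximal_S_free_point_near_extreme[OF assms, of "inverse (real (Suc t))"]) auto
  then obtain x where x: "\<And>t. x t \<in> S"
    "\<And>t \<beta>. \<beta> \<in> polar_about C p \<Longrightarrow> \<beta> \<bullet> (x t - p) \<ge> 1 \<Longrightarrow> dist \<alpha> \<beta> < inverse (real (Suc t))"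
    by metis
  have valid: "valid_ineq C \<alpha> (1 + \<alpha> \<bullet> p)"
    using assms(3) by (force simp: extreme_point_of_def polar_about_def valid_ineq_def inner_diff_right)
  have "(\<lambda>t. (\<delta> t, \<delta>0 t)) \<longlonglongrightarrow> (\<alpha>, 1 + \<alpha> \<bullet> p)"
    if \<delta>: "\<And>t. norm (\<delta> t) = norm \<alpha>" "\<And>t. valid_ineq C (\<delta> t) (\<delta>0 t)" "\<And>t. \<delta> t \<bullet> x t \<ge> \<delta>0 t"
    for \<delta> \<delta>0
  proof -
    \<comment> \<open>The slack at \<open>p\<close>. Dividing by it moves the inequality into the
      polar and turns \<open>\<delta> t \<bullet> x t \<ge> \<delta>0 t\<close> into
      \<open>\<beta> t \<bullet> (x t - p) \<ge> 1\<close>, the condition under which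
      \<open>x t\<close> forces closeness to \<alpha>.\<close>
    define c where "c t = \<delta>0 t - \<delta> t \<bullet> p" for t
    define \<beta> where "\<beta> t = (1 / c t) *\<^sub>R \<delta> t" for t
    have "\<delta> t \<noteq> 0" for t using \<delta>(1)[of t] assms(4) by auto
    then have strict: "\<delta> t \<bullet> p < \<delta>0 t" for t
      using valid_ineq_interior_strict \<delta>(2) assms(2) by blast
    then have c: "c t > 0" for t by (simp add: c_def)
    have "dist (\<beta> t) \<alpha> < inverse (real (Suc t))" for t
    proof -
      have "\<beta> t \<in> polar_about C p"
        unfolding \<beta>_def c_def by (rule scaled_valid_ineq_in_polar_about[OF \<delta>(2) strict])
      moreover have "\<beta> t \<bullet> (x t - p) \<ge> 1"
        using \<delta>(3)[of t] c[of t] by (simp add: \<beta>_def c_def inner_diff_right divide_simps)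
      ultimately show ?thesis using x(2)[of "\<beta> t" t] by (simp add: dist_commute)
    qed
    then have \<beta>lim: "\<beta> \<longlonglongrightarrow> \<alpha>"
      unfolding tendsto_dist_iff[of \<beta>]
      by (intro tendsto_sandwich[OF _ _ tendsto_const LIMSEQ_inverse_real_of_nat])
         (auto intro!: always_eventually less_imp_le)
    \<comment> \<open>The normalisation of \<open>\<delta>\<close> recovers the scaling factor from \<open>\<beta>\<close>.\<close>
    have "c t = norm \<alpha> / norm (\<beta> t)" for t
      using \<delta>(1)[of t] c[of t] assms(4) by (simp add: \<beta>_def)
    then have "c = (\<lambda>t. norm \<alpha> / norm (\<beta> t))" by (rule ext)
    moreover have "(\<lambda>t. norm \<alpha> / norm (\<beta> t)) \<longlonglongrightarrow> norm \<alpha> / norm \<alpha>"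
      using \<beta>lim assms(4) by (intro tendsto_intros) auto
    ultimately have clim: "c \<longlonglongrightarrow> 1" using assms(4) by simp
    have "c t *\<^sub>R \<beta> t = \<delta> t" for t using c[of t] by (simp add: \<beta>_def)
    then have \<delta>lim: "\<delta> \<longlonglongrightarrow> \<alpha>" using tendsto_scaleR[OF clim \<beta>lim] by simp
    have "c t + \<delta> t \<bullet> p = \<delta>0 t" for t by (simp add: c_def)
    then have "\<delta>0 \<longlonglongrightarrow> 1 + \<alpha> \<bullet> p"
      using tendsto_add[OF clim tendsto_inner[OF \<delta>lim tendsto_const[of p]]] by simp
    with \<delta>lim show ?thesis by (rule tendsto_Pair)
  qed
  then have "exposing_sequence C \<alpha> (1 + \<alpha> \<bullet> p) x"
    using assms(4) valid unfolding exposing_sequence_def by blast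
  with x(1) that show thesis by blast
qed

theorem theorem4:
  fixes S C :: "(real^'d) set"
  assumes "closed S"
    and "S_free S C"
    and "full_dimensional C"
  shows "maximal_S_free S C \<longleftrightarrow>
    (\<exists>I :: ((real^'d) \<times> real) set.
       C = {x. \<forall>(\<alpha>, \<alpha>0)\<in>I. \<alpha> \<bullet> x \<le> \<alpha>0} \<and>
       (\<forall>(\<alpha>, \<alpha>0)\<in>I. \<exists>x. (\<forall>t. x t \<in> S) \<and> exposing_sequence C \<alpha> \<alpha>0 x))"
    (is "_ \<longleftrightarrow> (\<exists>I. ?rep I \<and> ?exp I)")
proof
  assume max: "maximal_S_free S C"
  obtain p where p: "p \<in> interior C" using assms(3) by (auto simp: full_dimensional_def)
  \<comment> \<open>Taking all inequalities exposed from \<open>S\<close> makes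
    \<open>?exp I\<close> immediate; extreme points of the polar are needed only to show that
    \<open>I\<close> cuts off every point outside \<open>C\<close>.\<close>
  define I where "I = {(\<alpha>, \<alpha>0). (\<exists>x. (\<forall>t. x t \<in> S) \<and> exposing_sequence C \<alpha> \<alpha>0 x)}"
  have "?exp I" by (auto simp: I_def)
  moreover have "?rep I"
  proof
    show "C \<subseteq> {x. \<forall>(\<alpha>, \<alpha>0)\<in>I. \<alpha> \<bullet> x \<le> \<alpha>0}"
      by (auto simp: I_def exposing_sequence_def valid_ineq_def)
    show "{x. \<forall>(\<alpha>, \<alpha>0)\<in>I. \<alpha> \<bullet> x \<le> \<alpha>0} \<subseteq> C"
    proof (rule ccontr)
      assume "\<not> ?thesis"
      then obtain y where y: "\<forall>(\<alpha>, \<alpha>0)\<in>I. \<alpha> \<bullet> y \<le> \<alpha>0" "y \<notin> C" by blast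
      obtain \<alpha> where \<alpha>: "\<alpha> extreme_point_of polar_about C p" "\<alpha> \<bullet> (y - p) > 1"
        using extreme_polar_about_separates[OF _ _ p y(2)] assms(2) by (auto simp: S_free_def)
      \<comment> \<open>The origin may itself be an extreme point of the polar, but it cuts off
        nothing.\<close>
      have "\<alpha> \<noteq> 0" using \<alpha>(2) by auto
      then have "(\<alpha>, 1 + \<alpha> \<bullet> p) \<in> I"
        using exposing_sequence_extreme_polar_about[OF max p \<alpha>(1)] by (auto simp: I_def)
      then show False using y(1) \<alpha>(2) by (fastforce simp: inner_diff_right)
    qed
  qed
  ultimately show "\<exists>I. ?rep I \<and> ?exp I" by blast
next
  assume "\<exists>I. ?rep I \<and> ?exp I"
  then obtain I where I: "?rep I" "?exp I" by blast
  have "K \<subseteq> C" if K: "S_free S K" "C \<subseteq> K" for K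
  proof
    fix y assume y: "y \<in> K"
    have "\<alpha> \<bullet> y \<le> \<alpha>0" if "(\<alpha>, \<alpha>0) \<in> I" for \<alpha> \<alpha>0
    proof -
      obtain x where x: "\<forall>t. x t \<in> S" "exposing_sequence C \<alpha> \<alpha>0 x" using I(2) \<open>_ \<in> I\<close> by blast
      have "valid_ineq K \<alpha> \<alpha>0"
        \<comment> \<open>The points \<open>x t\<close> avoid \<open>interior K\<close> because they
          lie in \<open>S\<close> and \<open>K\<close> is \<open>S\<close>-free.\<close>
        using K x assms(3)
        by (intro exposed_ineq_valid_superset[OF _ K(2) _ x(2)])
           (auto simp: S_free_def full_dimensional_def)
      with y show ?thesis by (simp add: valid_ineq_def)
    qed
    then show "y \<in> C" by (subst I(1)) blast
  qed
  then show "maximal_S_free S C" using assms(2) by (auto simp: maximal_S_free_def)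
qed

end
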